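(* Let $X$ be a symplectic polytope in $\mathbb{R}^4$. Then for each face $F$ of $X$, the Reeb cone $R_F^+X$ is one-dimensional.
   Context: Identify $\mathbb{R}^{4}=\mathbb{C}^2$ with coordinates $z_j=x_j+\sqrt{-1}\,y_j$, $j=1,2$; $\mathbf{i}$ is the standard complex structure, $\langle\cdot,\cdot\rangle$ the Euclidean inner product, and $\omega_0=\sum_{j}dx_j\wedge dy_j$. A convex polytope $X$ is a compact set that is the intersection of finitely many closed half-spaces. A $k$-face of $X$ is a $k$-dimensional subset $F\subset\partial X$ which is the (relative) interior of the intersection with $\partial X$ of some set of the hyperplanes defining $X$; here $k\in\{0,1,2,3\}$, so faces are relatively open. For a compact convex set $X$ and $y\in\partial X$: the tangent cone $T_y^+X$ is the closure of the set of vectors $v$ such that $y+\epsilon v\in X$ for some $\epsilon>0$; the positive normal cone is $N_y^+X=\{v : \langle x-y,v\rangle\le 0\ \forall x\in X\}$; the Reeb cone is $R_y^+X=T_y^+X\cap \mathbf{i}N_y^+X$. For a polytope these cones are the same for all $y$ in a given face $F$, and are denoted $T_F^+X$, $N_F^+X$, $R_F^+X$. The dimension of a cone is the dimension of its linear span (a one-dimensional Reeb cone is a ray). A symplectic polytope in $\mathbb{R}^4$ is a convex polytope $X\subset\mathbb{R}^4$ with $0\in\operatorname{int}(X)$ such that no 2-face is Lagrangian, i.e. $\omega_0$ restricts to a nonzero 2-form on each 2-face. *)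

theory Defs
  imports "HOL-Analysis.Analysis"
begin

type_synonym C2 = "complex^2"

definition cstruct :: "C2 \<Rightarrow> C2" where
  "cstruct v = (\<chi> j. \<i> * v $ j)"

definition omega0 :: "C2 \<Rightarrow> C2 \<Rightarrow> real" where
  "omega0 v w = (\<Sum>j\<in>UNIV. Re (v $ j) * Im (w $ j) - Im (v $ j) * Re (w $ j))"

text \<open>A finite set \<open>H\<close> of pairs \<open>(a, b)\<close> stands for the half-spaces \<open>a \<bullet> x \<le> b\<close>, whose
  bounding hyperplanes are the hyperplanes defining \<open>X\<close>. No irredundancy is required.\<close>

definition defines_polytope :: "(C2 \<times> real) set \<Rightarrow> C2 set \<Rightarrow> bool" where
  "defines_polytope H X \<longleftrightarrow>
     finite H \<and> (\<forall>(a, b)\<in>H. a \<noteq> 0) \<and> X = (\<Inter>(a, b)\<in>H. {x. a \<bullet> x \<le> b}) \<and> compact X"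

lemma defines_polytope_imp_polytope:
  assumes "defines_polytope H X"
  shows "polytope X"
proof -
  have "polyhedron X"
    using assms unfolding defines_polytope_def
    by (auto intro!: polyhedron_Inter simp: polyhedron_halfspace_le)
  moreover have "bounded X"
    using assms compact_imp_bounded unfolding defines_polytope_def by blast
  ultimately show ?thesis
    by (simp add: polytope_eq_bounded_polyhedron)
qed

text \<open>Faces are relatively open. The choice \<open>S = {}\<close> contributes no face when \<open>X\<close> has nonempty
  interior, because then \<open>rel_interior (frontier X) = {}\<close>, which has \<open>aff_dim\<close> equal to \<open>-1\<close>.\<close>

definition kface :: "(C2 \<times> real) set \<Rightarrow> C2 set \<Rightarrow> nat \<Rightarrow> C2 set \<Rightarrow> bool" where
  "kface H X k F \<longleftrightarrow>
     k \<in> {0, 1, 2, 3} \<and> F \<subseteq> frontier X \<and> aff_dim F = int k \<and>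
     (\<exists>S\<subseteq>H. F = rel_interior (frontier X \<inter> (\<Inter>(a, b)\<in>S. {x. a \<bullet> x = b})))"

definition is_face :: "(C2 \<times> real) set \<Rightarrow> C2 set \<Rightarrow> C2 set \<Rightarrow> bool" where
  "is_face H X F \<longleftrightarrow> (\<exists>k. kface H X k F)"

definition face_tangent_space :: "C2 set \<Rightarrow> C2 set" where
  "face_tangent_space F = span {x - y | x y. x \<in> F \<and> y \<in> F}"

definition lagrangian_face :: "C2 set \<Rightarrow> bool" where
  "lagrangian_face F \<longleftrightarrow>
     (\<forall>v\<in>face_tangent_space F. \<forall>w\<in>face_tangent_space F. omega0 v w = 0)"

definition symplectic_polytope :: "(C2 \<times> real) set \<Rightarrow> C2 set \<Rightarrow> bool" where
  "symplectic_polytope H X \<longleftrightarrow>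
     defines_polytope H X \<and> 0 \<in> interior X \<and> (\<forall>F. kface H X 2 F \<longrightarrow> \<not> lagrangian_face F)"

definition tangent_cone :: "C2 set \<Rightarrow> C2 \<Rightarrow> C2 set" where
  "tangent_cone X y = closure {v. \<exists>\<epsilon>>0. y + \<epsilon> *\<^sub>R v \<in> X}"

definition normal_cone :: "C2 set \<Rightarrow> C2 \<Rightarrow> C2 set" where
  "normal_cone X y = {v. \<forall>x\<in>X. (x - y) \<bullet> v \<le> 0}"

definition reeb_cone :: "C2 set \<Rightarrow> C2 \<Rightarrow> C2 set" where
  "reeb_cone X y = tangent_cone X y \<inter> cstruct ` normal_cone X y"

end

theory Submission
  imports Defs
begin

text \<open>
  The argument treats all boundary points \<open>y\<close> of \<open>X\<close> at once. Write \<open>T\<close>, \<open>N\<close> and \<open>R = T \<inter> \<i>N\<close> for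
  the tangent, normal and Reeb cones at \<open>y\<close>.

  The Reeb cone of a closed convex set around \<open>0\<close> is nonzero (\<open>reeb_cone_nonzero\<close>). Since \<open>0\<close> is
  interior, \<open>N\<close> has the compact base \<open>B = {n \<in> N. n \<bullet> y = 1}\<close>. If \<open>T\<close> missed \<open>\<i>B\<close>, a hyperplane
  would separate them strictly. Its normal \<open>w\<close> is nonpositive on the cone \<open>T\<close>, so \<open>w \<in> N\<close>, and it is
  positive on all of \<open>\<i>N - {0}\<close>, in particular at \<open>\<i>w\<close>. But \<open>w \<bullet> \<i>w = 0\<close>.

  The Reeb cone contains no two independent vectors \<open>u\<close>, \<open>v\<close>. As \<open>T\<close> and \<open>N\<close> are
  polar, \<open>\<omega>(v, u) \<ge> 0\<close> for all \<open>u, v \<in> R\<close>, so by antisymmetry \<open>\<omega>\<close> vanishes on \<open>R\<close>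
  (\<open>omega0_reeb_cone\<close>). Hence \<open>u\<close> and \<open>v\<close> span a Lagrangian plane \<open>P\<close>, whose orthogonal complement
  is \<open>\<i>P\<close> (\<open>lagrangian_plane_orthogonal\<close>). The vectors \<open>-\<i>u\<close> and \<open>-\<i>v\<close> are outward normals
  at \<open>y\<close>, and the face of \<open>X\<close> that they expose lies in \<open>y + P\<close>. For a polytope, tangent vectors
  are directions in which one can actually move inside \<open>X\<close> (\<open>polytope_tangent_cone\<close>), so this
  face contains short segments from \<open>y\<close> in the directions \<open>u\<close> and \<open>v\<close> and is two-dimensional: a
  Lagrangian 2-face (\<open>independent_reeb_vectors_lagrangian_face\<close>). This is what a symplectic polytope
  excludes.
\<close>

section \<open>The complex structure and the symplectic form\<close>

lemma linear_cstruct: "linear cstruct"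
  by (rule linearI) (simp_all add: cstruct_def vec_eq_iff algebra_simps)

lemma cstruct_cstruct [simp]: "cstruct (cstruct v) = - v"
  by (simp add: cstruct_def vec_eq_iff)

lemma inner_cstruct_cstruct [simp]: "cstruct v \<bullet> cstruct w = v \<bullet> w"
  by (simp add: cstruct_def inner_vec_def inner_complex_def algebra_simps)

lemma omega0_eq_inner: "omega0 v w = cstruct v \<bullet> w"
  by (simp add: cstruct_def omega0_def inner_vec_def inner_complex_def algebra_simps)

lemma omega0_antisym: "omega0 v w = - omega0 w v"
  unfolding omega0_def sum_negf [symmetric] by (rule sum.cong) (simp_all add: mult.commute)

lemma omega0_self [simp]: "omega0 v v = 0"
  by (simp add: omega0_def algebra_simps)

lemma linear_omega0_left: "linear (\<lambda>v. omega0 v w)"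
  by (intro linearI) (simp_all add: omega0_eq_inner inner_left_distrib
    linear_add [OF linear_cstruct] linear_scale [OF linear_cstruct])

text \<open>A Lagrangian plane \<open>P\<close> in real dimension four satisfies \<open>P = (\<i>P)\<^sup>\<bottom>\<close>: the inclusion from left
  to right is the Lagrangian condition, and both sides have dimension two.\<close>

lemma lagrangian_plane_orthogonal:
  assumes indep: "independent {u, v}" and "u \<noteq> v" and "omega0 u v = 0"
  shows "{d. omega0 u d = 0 \<and> omega0 v d = 0} = span {u, v}" (is "?W = _")
    and "dim {d. omega0 u d = 0 \<and> omega0 v d = 0} = 2"
proof -
  let ?P = "span {u, v}" and ?iP = "cstruct ` span {u, v}"
  have dimP: "dim ?P = 2"
    using dim_eq_card_independent [OF indep] \<open>u \<noteq> v\<close> by (simp add: dim_span)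
  have "inj_on cstruct ?P"
    by (rule inj_on_inverseI [of _ "\<lambda>x. - cstruct x"]) simp
  then have dimiP: "dim ?iP = 2"
    using dim_image_eq [OF linear_cstruct, of ?P] dimP by (simp add: span_span)
  have W: "?W = {d \<in> UNIV. \<forall>x\<in>?iP. orthogonal x d}"
  proof (intro subset_antisym subsetI)
    fix d assume d: "d \<in> ?W"
    have "omega0 z d = 0" if "z \<in> ?P" for z
      using linear_eq_0_on_span [OF linear_omega0_left _ that, of d] d by auto
    then show "d \<in> {d \<in> UNIV. \<forall>x\<in>?iP. orthogonal x d}"
      by (simp add: orthogonal_def omega0_eq_inner)
  next
    fix d assume "d \<in> {d \<in> UNIV. \<forall>x\<in>?iP. orthogonal x d}"
    then have "orthogonal (cstruct z) d" if "z \<in> {u, v}" for z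
      using span_base [OF that] by simp
    then show "d \<in> ?W"
      by (simp add: orthogonal_def omega0_eq_inner)
  qed
  have "subspace ?iP"
    by (rule linear_subspace_image [OF linear_cstruct subspace_span])
  from dim_subspace_orthogonal_to_vectors [OF this subspace_UNIV]
  show dimW: "dim ?W = 2"
    using dimiP unfolding W by simp
  have subW: "subspace ?W"
    unfolding subspace_def omega0_eq_inner by (simp add: inner_right_distrib)
  have "?P \<subseteq> ?W"
    using subW assms(3) omega0_antisym [of v u] by (intro span_minimal) auto
  from subspace_dim_equal [OF subspace_span subW this] dimP dimW
  have "?P = ?W" by linarith
  then show "?W = ?P" ..
qed

section \<open>The cones of a convex set\<close>

lemma mem_normal_cone: "n \<in> normal_cone X y \<longleftrightarrow> (\<forall>x\<in>X. n \<bullet> x \<le> n \<bullet> y)"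
  unfolding normal_cone_def by (simp add: inner_commute [of "_ - _" n] inner_diff_right)

lemma tangent_inner_normal_nonpos:
  assumes "u \<in> tangent_cone X y" "n \<in> normal_cone X y"
  shows "n \<bullet> u \<le> 0"
proof -
  have "{v. \<exists>\<epsilon>>0. y + \<epsilon> *\<^sub>R v \<in> X} \<subseteq> {v. n \<bullet> v \<le> 0}"
  proof clarify
    fix v and \<epsilon> :: real
    assume "\<epsilon> > 0" "y + \<epsilon> *\<^sub>R v \<in> X"
    then have "(y + \<epsilon> *\<^sub>R v - y) \<bullet> n \<le> 0"
      using assms(2) unfolding normal_cone_def by blast
    then show "n \<bullet> v \<le> 0"
      using \<open>\<epsilon> > 0\<close> by (simp add: inner_commute mult_le_0_iff)
  qed
  then have "tangent_cone X y \<subseteq> {v. n \<bullet> v \<le> 0}"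
    unfolding tangent_cone_def by (rule closure_minimal) (rule closed_halfspace_le)
  with assms(1) show ?thesis by blast
qed

lemma reeb_cone_normal:
  assumes "v \<in> reeb_cone X y"
  shows "- cstruct v \<in> normal_cone X y"
  using assms unfolding reeb_cone_def by auto

text \<open>Polarity of the tangent and normal cones gives one sign for \<open>omega0 u v\<close>, and exchanging the
  two vectors gives the other.\<close>

lemma omega0_reeb_cone:
  assumes "u \<in> reeb_cone X y" "v \<in> reeb_cone X y"
  shows "omega0 u v = 0"
proof -
  have nonneg: "omega0 a b \<ge> 0" if "a \<in> reeb_cone X y" "b \<in> reeb_cone X y" for a b
    using tangent_inner_normal_nonpos [of b X y "- cstruct a"] reeb_cone_normal [OF that(1)] that(2)
    by (simp add: reeb_cone_def omega0_eq_inner)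
  show ?thesis
    using nonneg [OF assms] nonneg [OF assms(2,1)] omega0_antisym [of u v] by linarith
qed

text \<open>Moving by less in an admissible direction stays admissible.\<close>

lemma convex_step_mono:
  assumes "convex X" "y \<in> X" "y + \<epsilon> *\<^sub>R v \<in> X" "0 \<le> \<delta>" "\<delta> \<le> \<epsilon>"
  shows "y + \<delta> *\<^sub>R v \<in> X"
proof (cases "\<epsilon> = 0")
  case False
  then have "\<epsilon> > 0" using assms by simp
  have "(1 - \<delta> / \<epsilon>) *\<^sub>R y + (\<delta> / \<epsilon>) *\<^sub>R (y + \<epsilon> *\<^sub>R v) \<in> X"
    using assms \<open>\<epsilon> > 0\<close> by (intro convexD) (auto simp: divide_simps)
  moreover have "(1 - \<delta> / \<epsilon>) *\<^sub>R y + (\<delta> / \<epsilon>) *\<^sub>R (y + \<epsilon> *\<^sub>R v) = y + \<delta> *\<^sub>R v"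
    using \<open>\<epsilon> > 0\<close> by (simp add: algebra_simps)
  ultimately show ?thesis by simp
qed (use assms in simp)

lemma convex_tangent_cone:
  assumes "convex X" "y \<in> X"
  shows "convex (tangent_cone X y)"
  unfolding tangent_cone_def
proof (intro convex_closure convexI)
  fix v w :: C2 and s t :: real
  assume v: "v \<in> {v. \<exists>\<epsilon>>0. y + \<epsilon> *\<^sub>R v \<in> X}" and w: "w \<in> {v. \<exists>\<epsilon>>0. y + \<epsilon> *\<^sub>R v \<in> X}"
    and st: "0 \<le> s" "0 \<le> t" "s + t = 1"
  from v w obtain \<epsilon> \<delta> where pos: "\<epsilon> > 0" "\<delta> > 0"
    and mem: "y + \<epsilon> *\<^sub>R v \<in> X" "y + \<delta> *\<^sub>R w \<in> X" by blast
  define \<gamma> where "\<gamma> = min \<epsilon> \<delta>"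
  have "\<gamma> > 0" using pos by (simp add: \<gamma>_def)
  have "y + \<gamma> *\<^sub>R v \<in> X" "y + \<gamma> *\<^sub>R w \<in> X"
    using convex_step_mono [OF assms mem(1)] convex_step_mono [OF assms mem(2)] pos
    by (auto simp: \<gamma>_def)
  then have "s *\<^sub>R (y + \<gamma> *\<^sub>R v) + t *\<^sub>R (y + \<gamma> *\<^sub>R w) \<in> X"
    using assms(1) st by (simp add: convexD)
  moreover have "s *\<^sub>R (y + \<gamma> *\<^sub>R v) + t *\<^sub>R (y + \<gamma> *\<^sub>R w)
      = (s + t) *\<^sub>R y + \<gamma> *\<^sub>R (s *\<^sub>R v + t *\<^sub>R w)"
    by (simp add: algebra_simps)
  ultimately show "s *\<^sub>R v + t *\<^sub>R w \<in> {v. \<exists>\<epsilon>>0. y + \<epsilon> *\<^sub>R v \<in> X}"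
    using st \<open>\<gamma> > 0\<close> by auto
qed

text \<open>This makes \<open>{n \<in> N. n \<bullet> y = 1}\<close> a bounded base of the normal cone: a ball about the origin
  inside \<open>X\<close> contains a positive multiple of the normal vector itself.\<close>

lemma normal_cone_inner_ge:
  assumes ball: "cball 0 r \<subseteq> X" and "0 \<le> r" and n: "n \<in> normal_cone X y"
  shows "r * norm n \<le> n \<bullet> y"
proof (cases "n = 0")
  case False
  have "(r / norm n) *\<^sub>R n \<in> X"
    using ball \<open>0 \<le> r\<close> False by (intro subsetD [OF ball]) simp
  then have "((r / norm n) *\<^sub>R n - y) \<bullet> n \<le> 0"
    using n unfolding normal_cone_def by blast
  then have "(r / norm n) * (norm n)\<^sup>2 \<le> n \<bullet> y"
    by (simp add: inner_diff_left inner_commute [of y] power2_norm_eq_inner)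
  then show ?thesis
    using False by (simp add: power2_eq_square)
qed simp

lemma normal_cone_scale:
  assumes "n \<in> normal_cone X y" "0 \<le> c"
  shows "c *\<^sub>R n \<in> normal_cone X y"
  using assms unfolding normal_cone_def by (simp add: mult_nonneg_nonpos)

lemma closed_normal_cone: "closed (normal_cone X y)"
proof -
  have "normal_cone X y = (\<Inter>x\<in>X. {v. (x - y) \<bullet> v \<le> 0})"
    unfolding normal_cone_def by auto
  then show ?thesis
    by (simp add: closed_INT closed_halfspace_le)
qed

lemma convex_normal_cone: "convex (normal_cone X y)"
proof -
  have "normal_cone X y = (\<Inter>x\<in>X. {v. (x - y) \<bullet> v \<le> 0})"
    unfolding normal_cone_def by auto
  then show ?thesis
    by (simp add: convex_INT convex_halfspace_le)
qed

lemma normal_cone_nonzero: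
  assumes "convex X" "interior X \<noteq> {}" "y \<in> frontier X"
  obtains n where "n \<in> normal_cone X y" "n \<noteq> 0"
proof -
  have y: "y \<in> closure X" "y \<notin> rel_interior X"
    using assms(3) rel_interior_nonempty_interior [OF assms(2)] unfolding frontier_def by auto
  obtain a where "a \<noteq> 0" and le: "\<And>x. x \<in> closure X \<Longrightarrow> a \<bullet> y \<le> a \<bullet> x"
    by (metis supporting_hyperplane_relative_frontier [OF assms(1) y])
  have "- a \<in> normal_cone X y"
    using le subsetD [OF closure_subset] by (auto simp: mem_normal_cone)
  then show thesis using \<open>a \<noteq> 0\<close> that by simp
qed

text \<open>If the tangent cone missed \<open>\<i>\<close> times a base of the normal cone, then a vector strictly
  separating the two would itself be a normal vector \<open>w\<close> with \<open>w \<bullet> \<i>w > 0\<close>.\<close>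

lemma reeb_cone_nonzero:
  assumes conv: "convex X" and "closed X" and int: "0 \<in> interior X" and y: "y \<in> frontier X"
  obtains v where "v \<in> reeb_cone X y" "v \<noteq> 0"
proof -
  have "y \<in> X"
    using y \<open>closed X\<close> frontier_subset_closed by blast
  obtain r where "r > 0" and ball: "cball 0 r \<subseteq> X"
    using int mem_interior_cball by blast
  define B where "B = {n \<in> normal_cone X y. y \<bullet> n = 1}"
  have B_eq: "B = normal_cone X y \<inter> {n. y \<bullet> n = 1}"
    unfolding B_def by auto
  have rescale: "(1 / (y \<bullet> n)) *\<^sub>R n \<in> B" and pos: "y \<bullet> n > 0"
    if "n \<in> normal_cone X y" "n \<noteq> 0" for n
  proof -
    have "0 < r * norm n" using \<open>r > 0\<close> that by simp
    then show p: "y \<bullet> n > 0"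
      using normal_cone_inner_ge [OF ball _ that(1)] \<open>r > 0\<close> by (simp add: inner_commute)
    show "(1 / (y \<bullet> n)) *\<^sub>R n \<in> B"
      using p normal_cone_scale [OF that(1), of "1 / (y \<bullet> n)"] by (simp add: B_def)
  qed
  have "norm n \<le> 1 / r" if "n \<in> B" for n
  proof -
    have "r * norm n \<le> n \<bullet> y"
      using normal_cone_inner_ge [OF ball] \<open>r > 0\<close> that by (simp add: B_def)
    then show ?thesis
      using \<open>r > 0\<close> that by (simp add: B_def inner_commute field_simps)
  qed
  then have "bounded B"
    by (auto simp: bounded_iff)
  then have "compact B"
    unfolding compact_eq_bounded_closed B_eq
    by (simp add: closed_Int closed_normal_cone closed_hyperplane)
  then have cpt: "compact (cstruct ` B)"
    by (intro compact_continuous_image linear_continuous_on)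
      (simp add: linear_cstruct flip: linear_conv_bounded_linear)
  have "convex B"
    unfolding B_eq by (simp add: convex_Int convex_normal_cone convex_hyperplane)
  then have cvx: "convex (cstruct ` B)"
    by (rule convex_linear_image [OF linear_cstruct])
  have "B \<noteq> {}"
    using normal_cone_nonzero [OF conv _ y] int rescale by blast
  have "tangent_cone X y \<inter> cstruct ` B \<noteq> {}"
  proof
    assume disj: "tangent_cone X y \<inter> cstruct ` B = {}"
    have "closed (tangent_cone X y)"
      unfolding tangent_cone_def by simp
    with separating_hyperplane_closed_compact
      [OF convex_tangent_cone [OF conv \<open>y \<in> X\<close>] _ cvx cpt _ disj]
    obtain w c where below: "\<And>v. v \<in> tangent_cone X y \<Longrightarrow> w \<bullet> v < c"
      and above: "\<And>n. n \<in> B \<Longrightarrow> w \<bullet> cstruct n > c"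
      using \<open>B \<noteq> {}\<close> by auto
    have tangent: "t *\<^sub>R (x - y) \<in> tangent_cone X y" if "x \<in> X" "t > 0" for x t
    proof -
      have "y + (1 / t) *\<^sub>R (t *\<^sub>R (x - y)) \<in> X" using that by simp
      then show ?thesis
        unfolding tangent_cone_def using that(2)
        by (intro subsetD [OF closure_subset] CollectI exI [of _ "1 / t"]) simp
    qed
    have "c > 0"
      using below [OF tangent [OF \<open>y \<in> X\<close>, of 1]] by simp
    have "w \<in> normal_cone X y"
      unfolding mem_normal_cone
    proof (rule ballI, rule ccontr)
      fix x assume "x \<in> X" and "\<not> w \<bullet> x \<le> w \<bullet> y"
      then have p: "w \<bullet> (x - y) > 0" by (simp add: inner_diff_right)
      \<comment> \<open>A bound on a ray of the cone forces a nonpositive slope: go so far that \<open>w\<close> takes the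
        value \<open>c\<close>.\<close>
      have "w \<bullet> ((c / (w \<bullet> (x - y))) *\<^sub>R (x - y)) < c"
        using p \<open>c > 0\<close> by (intro below tangent [OF \<open>x \<in> X\<close>]) simp
      with p show False by simp
    qed
    moreover have "w \<noteq> 0"
      using above \<open>B \<noteq> {}\<close> \<open>c > 0\<close> by force
    ultimately have "w \<bullet> cstruct ((1 / (y \<bullet> w)) *\<^sub>R w) > c"
      using above rescale by blast
    moreover have "w \<bullet> cstruct w = 0"
      using omega0_self [of w] by (simp only: omega0_eq_inner inner_commute [of w "cstruct w"])
    ultimately show False
      using \<open>c > 0\<close> by (simp add: linear_scale [OF linear_cstruct])
  qed
  then obtain n where n: "n \<in> B" "cstruct n \<in> tangent_cone X y" by blast
  show thesis
  proof
    show "cstruct n \<in> reeb_cone X y"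
      using n unfolding reeb_cone_def B_def by blast
    have "n \<noteq> 0" using n(1) by (auto simp: B_def)
    then show "cstruct n \<noteq> 0"
      using inner_cstruct_cstruct [of n n] by (metis inner_eq_zero_iff)
  qed
qed

section \<open>Faces of a polytope\<close>

lemma defines_polytope_iff:
  assumes "defines_polytope H X"
  shows "x \<in> X \<longleftrightarrow> (\<forall>(a, b)\<in>H. a \<bullet> x \<le> b)"
  using assms unfolding defines_polytope_def by auto

text \<open>Only the finitely many constraints that are strict at the starting point limit how far one can
  go in a direction that respects the active ones, so some positive step is possible.\<close>

lemma active_step:
  assumes H: "defines_polytope H X" and "p \<in> X"
    and active: "\<And>a b. (a, b) \<in> H \<Longrightarrow> a \<bullet> p = b \<Longrightarrow> a \<bullet> v \<le> 0"
  obtains \<epsilon> where "\<epsilon> > 0" "p + \<epsilon> *\<^sub>R v \<in> X"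
proof -
  have fin: "finite H" using H unfolding defines_polytope_def by blast
  have "\<forall>\<^sub>F e in at_right 0. \<forall>h\<in>H. fst h \<bullet> (p + e *\<^sub>R v) \<le> snd h"
  proof (intro eventually_ball_finite fin ballI)
    fix h assume "h \<in> H"
    obtain a b where h: "h = (a, b)" by (cases h)
    have le: "a \<bullet> p \<le> b"
      using \<open>p \<in> X\<close> \<open>h \<in> H\<close> h defines_polytope_iff [OF H] by blast
    show "\<forall>\<^sub>F e in at_right 0. fst h \<bullet> (p + e *\<^sub>R v) \<le> snd h"
    proof (cases "a \<bullet> p = b")
      case True
      then have "a \<bullet> v \<le> 0" using active \<open>h \<in> H\<close> h by blast
      then have "a \<bullet> (p + e *\<^sub>R v) \<le> b" if "e > 0" for e :: real
        using that True by (simp add: inner_right_distrib mult_nonneg_nonpos)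
      then show ?thesis
        using eventually_mono [OF eventually_at_right_less [of "0::real"]] by (simp add: h)
    next
      case False
      have "((\<lambda>e. a \<bullet> (p + e *\<^sub>R v)) \<longlongrightarrow> a \<bullet> (p + 0 *\<^sub>R v)) (at_right 0)"
        by (intro tendsto_intros)
      then have "\<forall>\<^sub>F e in at_right 0. a \<bullet> (p + e *\<^sub>R v) < b"
        using False le by (intro order_tendstoD(2)) auto
      then show ?thesis
        by (rule eventually_mono) (simp add: h)
    qed
  qed
  then have "\<forall>\<^sub>F e in at_right (0::real). e > 0 \<and> p + e *\<^sub>R v \<in> X"
    using eventually_at_right_less [of 0]
    by eventually_elim (auto simp: defines_polytope_iff [OF H])
  then show thesis
    using that eventually_happens' [OF trivial_limit_at_right_real] by blast
qed

text \<open>For a polytope the closure in the tangent cone adds nothing: limits of admissible directions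
  still respect the active constraints.\<close>

lemma polytope_tangent_cone:
  assumes H: "defines_polytope H X" and "y \<in> X" and v: "v \<in> tangent_cone X y"
  obtains \<epsilon> where "\<epsilon> > 0" "y + \<epsilon> *\<^sub>R v \<in> X"
proof (rule active_step [OF H \<open>y \<in> X\<close>])
  fix a b assume ab: "(a, b) \<in> H" "a \<bullet> y = b"
  have "a \<bullet> x \<le> a \<bullet> y" if "x \<in> X" for x
    using that ab defines_polytope_iff [OF H] by blast
  then have "a \<in> normal_cone X y"
    by (simp add: mem_normal_cone)
  then show "a \<bullet> v \<le> 0"
    by (rule tangent_inner_normal_nonpos [OF v])
qed (rule that)

text \<open>With possibly redundant constraints, an exposed face \<open>G\<close> is still cut out by the bounding
  hyperplanes that are active at one of its relative interior points \<open>p\<close>. They contain \<open>G\<close> because a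
  linear function maximal at \<open>p\<close> is constant on \<open>G\<close>. Conversely, from a point \<open>x \<in> X\<close> on these
  hyperplanes the segment to \<open>p\<close> can be prolonged beyond \<open>p\<close> inside \<open>X\<close>, so the functional that
  exposes \<open>G\<close> is maximal inside a segment from \<open>x\<close>, hence also at \<open>x\<close>.\<close>

lemma exposed_face_active_hyperplanes:
  assumes H: "defines_polytope H X"
    and n: "n \<in> normal_cone X y" and "y \<in> X"
  defines "G \<equiv> {x \<in> X. n \<bullet> (x - y) = 0}"
  obtains S where "S \<subseteq> H" "G = X \<inter> (\<Inter>(a, b)\<in>S. {x. a \<bullet> x = b})"
proof -
  have "convex X"
    using defines_polytope_imp_polytope [OF H] polytope_imp_convex by blast
  have "G = X \<inter> {x. n \<bullet> x = n \<bullet> y}"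
    unfolding G_def by (auto simp: inner_diff_right)
  then have "convex G"
    using \<open>convex X\<close> by (simp add: convex_Int convex_hyperplane)
  moreover have "G \<noteq> {}"
    using \<open>y \<in> X\<close> unfolding G_def by auto
  ultimately obtain p where p: "p \<in> rel_interior G"
    using rel_interior_eq_empty by blast
  then have "p \<in> G" using rel_interior_subset by blast
  then have "p \<in> X" and np: "n \<bullet> (p - y) = 0" unfolding G_def by auto
  define S where "S = {(a, b) \<in> H. a \<bullet> p = b}"
  show thesis
  proof
    show "S \<subseteq> H" unfolding S_def by auto
    show "G = X \<inter> (\<Inter>(a, b)\<in>S. {x. a \<bullet> x = b})" (is "_ = ?R")
    proof
      show "G \<subseteq> ?R"
      proof
        fix x assume "x \<in> G"
        then have "x \<in> X" unfolding G_def by simp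
        have "a \<bullet> x = b" if ab: "(a, b) \<in> H" "a \<bullet> p = b" for a b
        proof -
          have le: "a \<bullet> z \<le> b" if "z \<in> X" for z
            using that ab(1) defines_polytope_iff [OF H] by blast
          obtain e where e: "e > 1" "(1 - e) *\<^sub>R x + e *\<^sub>R p \<in> G"
            using convex_rel_interior_iff [OF \<open>convex G\<close> \<open>G \<noteq> {}\<close>] p \<open>x \<in> G\<close> by blast
          have "a \<bullet> ((1 - e) *\<^sub>R x + e *\<^sub>R p) \<le> b"
            using e(2) le unfolding G_def by blast
          then have "(e - 1) * b \<le> (e - 1) * (a \<bullet> x)"
            using ab(2) by (simp add: inner_right_distrib algebra_simps)
          then have "b \<le> a \<bullet> x" using e(1) by simp
          with le [OF \<open>x \<in> X\<close>] show ?thesis by simp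
        qed
        then show "x \<in> ?R" using \<open>x \<in> X\<close> unfolding S_def by auto
      qed
      show "?R \<subseteq> G"
      proof
        fix x assume "x \<in> ?R"
        then have "x \<in> X" and eq: "\<And>a b. (a, b) \<in> H \<Longrightarrow> a \<bullet> p = b \<Longrightarrow> a \<bullet> x = b"
          unfolding S_def by auto
        obtain \<epsilon> where "\<epsilon> > 0" and mem: "p + \<epsilon> *\<^sub>R (p - x) \<in> X"
          by (rule active_step [OF H \<open>p \<in> X\<close>, of "p - x"]) (auto simp: inner_diff_right eq)
        have le: "n \<bullet> (z - y) \<le> 0" if "z \<in> X" for z
          using n that by (simp add: mem_normal_cone inner_diff_right)
        have "n \<bullet> (p + \<epsilon> *\<^sub>R (p - x) - y) = (1 + \<epsilon>) * (n \<bullet> (p - y)) - \<epsilon> * (n \<bullet> (x - y))"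
          by (simp add: inner_diff_right inner_add_right algebra_simps)
        with le [OF mem] np \<open>\<epsilon> > 0\<close> have "n \<bullet> (x - y) \<ge> 0"
          by (simp add: zero_le_mult_iff)
        with le [OF \<open>x \<in> X\<close>] \<open>x \<in> X\<close> show "x \<in> G" unfolding G_def by auto
      qed
    qed
  qed
qed

lemma exposed_face_subset_frontier:
  assumes "n \<in> normal_cone X y" "n \<noteq> 0" "closed X"
  shows "{x \<in> X. n \<bullet> (x - y) = 0} \<subseteq> frontier X"
proof
  fix x assume x: "x \<in> {x \<in> X. n \<bullet> (x - y) = 0}"
  have "x \<notin> interior X"
  proof
    have "X \<subseteq> {z. n \<bullet> z \<le> n \<bullet> y}"
      using assms(1) by (auto simp: mem_normal_cone)
    then have "interior X \<subseteq> {z. n \<bullet> z < n \<bullet> y}"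
      using interior_mono interior_halfspace_le [OF assms(2)] by metis
    moreover assume "x \<in> interior X"
    ultimately show False using x by (auto simp: inner_diff_right)
  qed
  then show "x \<in> frontier X"
    using x \<open>closed X\<close> by (simp add: frontier_def)
qed

section \<open>The Reeb cone of a symplectic polytope\<close>

text \<open>The 2-face is the one exposed by the outward normal \<open>-\<i>(u + v)\<close>. On \<open>X\<close> the functionals
  of \<open>-\<i>u\<close> and \<open>-\<i>v\<close> are both maximal at \<open>y\<close>, so their sum is maximal only where each of them
  is; this puts the face into the Lagrangian plane through \<open>y\<close> spanned by \<open>u\<close> and \<open>v\<close>.\<close>

lemma independent_reeb_vectors_lagrangian_face:
  assumes H: "defines_polytope H X" and "y \<in> X"
    and u: "u \<in> reeb_cone X y" and v: "v \<in> reeb_cone X y"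
    and indep: "independent {u, v}" and "u \<noteq> v"
  obtains F where "kface H X 2 F" "lagrangian_face F"
proof -
  have "convex X" and "closed X"
    using defines_polytope_imp_polytope [OF H] polytope_imp_convex polytope_imp_closed by blast+
  define n where "n = - cstruct u - cstruct v"
  define G where "G = {x \<in> X. n \<bullet> (x - y) = 0}"
  let ?W = "{d. omega0 u d = 0 \<and> omega0 v d = 0}"
  have uv: "omega0 u v = 0"
    by (rule omega0_reeb_cone [OF u v])
  note W = lagrangian_plane_orthogonal [OF indep \<open>u \<noteq> v\<close> uv]
  have nonneg: "omega0 u (x - y) \<ge> 0" "omega0 v (x - y) \<ge> 0" if "x \<in> X" for x
    using reeb_cone_normal [OF u] reeb_cone_normal [OF v] that
    by (auto simp: mem_normal_cone omega0_eq_inner inner_diff_right)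
  have n_omega: "n \<bullet> d = - omega0 u d - omega0 v d" for d
    by (simp add: n_def omega0_eq_inner inner_diff_left)
  have "n \<bullet> x \<le> n \<bullet> y" if "x \<in> X" for x
    using nonneg [OF that] n_omega [of "x - y"] unfolding inner_diff_right by linarith
  then have n: "n \<in> normal_cone X y"
    by (simp add: mem_normal_cone)
  have "n \<noteq> 0"
  proof
    assume "n = 0"
    then have "- cstruct u = cstruct v"
      by (simp add: n_def)
    then have "cstruct u = cstruct (- v)"
      by (metis linear_neg [OF linear_cstruct] minus_minus)
    then have "u = - v"
      using cstruct_cstruct neg_equal_iff_equal by metis
    then have "u \<in> span {v}"
      by (simp add: span_base span_neg)
    then show False
      using indep \<open>u \<noteq> v\<close> by (simp add: independent_insert)
  qed
  have G_W: "x - y \<in> ?W" if "x \<in> G" for x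
    using that nonneg [of x] unfolding G_def by (auto simp: n_omega)
  obtain S where "S \<subseteq> H" and G_S: "G = X \<inter> (\<Inter>(a, b)\<in>S. {x. a \<bullet> x = b})"
    using exposed_face_active_hyperplanes [OF H n \<open>y \<in> X\<close>] unfolding G_def by blast
  have G_frontier: "G \<subseteq> frontier X"
    unfolding G_def by (rule exposed_face_subset_frontier [OF n \<open>n \<noteq> 0\<close> \<open>closed X\<close>])
  then have G_face: "G = frontier X \<inter> (\<Inter>(a, b)\<in>S. {x. a \<bullet> x = b})"
    using G_S frontier_subset_closed [OF \<open>closed X\<close>] by blast
  have "convex G"
    unfolding G_S using \<open>convex X\<close>
    by (intro convex_Int convex_INT) (auto intro: convex_hyperplane)
  have "y \<in> G"
    using \<open>y \<in> X\<close> unfolding G_def by simp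
  have "aff_dim G = 2"
  proof -
    let ?D = "(+) (- y) ` G"
    have "?D \<subseteq> ?W"
      using G_W by (auto simp: algebra_simps)
    then have le: "dim ?D \<le> 2"
      using dim_subset [of ?D ?W] W(2) by simp
    have in_span: "w \<in> span ?D" if w: "w \<in> reeb_cone X y" "w \<in> ?W" for w
    proof -
      obtain \<epsilon> where "\<epsilon> > 0" "y + \<epsilon> *\<^sub>R w \<in> X"
        using polytope_tangent_cone [OF H \<open>y \<in> X\<close>] w(1) unfolding reeb_cone_def by blast
      then have "y + \<epsilon> *\<^sub>R w \<in> G"
        using w(2) unfolding G_def by (simp add: n_omega omega0_eq_inner)
      then have "\<epsilon> *\<^sub>R w \<in> ?D"
        by (intro image_eqI [of _ _ "y + \<epsilon> *\<^sub>R w"]) simp_all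
      then have "(1 / \<epsilon>) *\<^sub>R (\<epsilon> *\<^sub>R w) \<in> span ?D"
        by (intro span_scale span_base)
      then show ?thesis using \<open>\<epsilon> > 0\<close> by simp
    qed
    have "{u, v} \<subseteq> span ?D"
      using in_span u v uv omega0_antisym [of v u] by auto
    then have "card {u, v} \<le> dim ?D"
      using independent_card_le_dim [OF _ indep, of "span ?D"] by (simp add: dim_span)
    then have "dim ?D = 2"
      using le \<open>u \<noteq> v\<close> by simp
    then show ?thesis
      using aff_dim_eq_dim [OF hull_inc [OF \<open>y \<in> G\<close>]] by simp
  qed
  show thesis
  proof
    show "kface H X 2 (rel_interior G)"
      unfolding kface_def
    proof (intro conjI exI [of _ S])
      show "rel_interior G \<subseteq> frontier X"
        using rel_interior_subset G_frontier by blast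
      show "aff_dim (rel_interior G) = int 2"
        using \<open>aff_dim G = 2\<close> rel_interior_aff_dim [OF \<open>convex G\<close>] by simp
      show "rel_interior G = rel_interior (frontier X \<inter> (\<Inter>(a, b)\<in>S. {x. a \<bullet> x = b}))"
        using G_face by simp
    qed (use \<open>S \<subseteq> H\<close> in simp_all)
    have tangent: "face_tangent_space (rel_interior G) \<subseteq> ?W"
      unfolding face_tangent_space_def W(1)
    proof (rule span_minimal)
      show "{x - z |x z. x \<in> rel_interior G \<and> z \<in> rel_interior G} \<subseteq> span {u, v}"
      proof clarify
        fix x z assume "x \<in> rel_interior G" "z \<in> rel_interior G"
        then have "x - y \<in> span {u, v}" "z - y \<in> span {u, v}"
          using G_W rel_interior_subset W(1) by blast+
        from span_diff [OF this] show "x - z \<in> span {u, v}" by simp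
      qed
    qed (rule subspace_span)
    have "omega0 d e = 0" if "d \<in> ?W" "e \<in> ?W" for d e
    proof -
      have "d \<in> span {u, v}" using that(1) W(1) by blast
      \<comment> \<open>\<open>e\<close> is \<open>omega0\<close>-orthogonal to both generators, hence to everything they span.\<close>
      then show ?thesis
        using linear_eq_0_on_span [OF linear_omega0_left, of "{u, v}" e d] that(2) by auto
    qed
    then show "lagrangian_face (rel_interior G)"
      unfolding lagrangian_face_def using tangent by blast
  qed
qed

theorem proposition1p5:
  fixes H :: "(C2 \<times> real) set" and X F :: "C2 set"
  assumes "symplectic_polytope H X"
    and "is_face H X F"
  shows "\<forall>y\<in>F. dim (reeb_cone X y) = 1"
proof
  fix y assume "y \<in> F"
  have H: "defines_polytope H X" and int: "0 \<in> interior X"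
    and symp: "\<And>F'. kface H X 2 F' \<Longrightarrow> \<not> lagrangian_face F'"
    using assms(1) unfolding symplectic_polytope_def by auto
  have "convex X" and "closed X"
    using defines_polytope_imp_polytope [OF H] polytope_imp_convex polytope_imp_closed by blast+
  have y: "y \<in> frontier X"
    using assms(2) \<open>y \<in> F\<close> unfolding is_face_def kface_def by blast
  then have "y \<in> X"
    using \<open>closed X\<close> frontier_subset_closed by blast
  obtain B where B: "B \<subseteq> reeb_cone X y" "independent B" "card B = dim (reeb_cone X y)"
    using basis_exists by metis
  have "dim (reeb_cone X y) \<le> 1"
  proof (rule ccontr)
    assume "\<not> dim (reeb_cone X y) \<le> 1"
    then have "2 \<le> card B"
      using B(3) by simp
    then obtain T where "T \<subseteq> B" "card T = 2"
      using obtain_subset_with_card_n by metis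
    then obtain u v where uv: "{u, v} \<subseteq> B" "u \<noteq> v"
      by (auto simp: card_2_iff)
    then have "independent {u, v}"
      using B(2) independent_mono by blast
    then show False
      using independent_reeb_vectors_lagrangian_face [OF H \<open>y \<in> X\<close>] uv B(1) symp
      by (metis insert_subset subsetD)
  qed
  moreover have "dim (reeb_cone X y) \<noteq> 0"
    using reeb_cone_nonzero [OF \<open>convex X\<close> \<open>closed X\<close> int y] by (auto simp: dim_eq_0)
  ultimately show "dim (reeb_cone X y) = 1" by linarith
qed

end
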